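(* There exist a number of agents $n$ and an admissible distribution $P$ on $[0,1]^n$ under which, for the egalitarian welfare $w(B)=\min_i B^i$, $$\mathsf{FLU}-\mathbb{E}[\mathsf{OPT}]=\Omega(\sqrt{T}),$$ i.e. $\liminf_{T\to\infty}\left(\mathsf{FLU}-\mathbb{E}[\mathsf{OPT}]\right)/\sqrt{T}>0$.
   Context: There are $n$ agents and $T$ periods. $\Delta_n=\{x\in\mathbb{R}_+^n:\sum_i x^i=1\}$. A distribution $P$ on $[0,1]^n$ is admissible if it has finite support: $P\{b=\beta_\ell\}=p_\ell>0$ for $\ell\in[L]=\{1,\dots,L\}$, with distinct $\beta_\ell\in[0,1]^n$ and $\sum_\ell p_\ell=1$. The marginal utility vectors $b_1,\dots,b_T$ are i.i.d. with law $P$. Hindsight optimum: $\mathsf{OPT}=\max\left\{\min_i\sum_{t=1}^T b_t^i x_t^i: x_1,\dots,x_T\in\Delta_n\right\}$ for the realized sequence. Fluid benchmark: $\mathsf{FLU}=\max\left\{\min_i T\sum_{\ell\in[L]}p_\ell\beta_\ell^i\xi_\ell^i:\boldsymbol\xi=(\xi_\ell)_{\ell\in[L]}\in\Delta_n^L\right\}$. *)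

theory Defs
  imports "HOL-Probability.Probability"
begin

text \<open>
  The number of agents is quantified inside the statement, so a vector of \<open>\<real>\<^sup>n\<close> is a function
  \<open>nat \<Rightarrow> real\<close> on the index set \<open>{..<n}\<close> that is \<open>undefined\<close> elsewhere; thus distinct functions
  are distinct vectors.
\<close>

definition unit_simplex :: "nat \<Rightarrow> (nat \<Rightarrow> real) set" where
  "unit_simplex n = {x \<in> {..<n} \<rightarrow>\<^sub>E {0..}. (\<Sum>i<n. x i) = 1}"

text \<open>
  The distinct atoms \<open>\<beta>\<^sub>1, \<dots>, \<beta>\<^sub>L\<close> are the elements of \<open>set_pmf P\<close>, with \<open>pmf P \<beta> > 0\<close> their
  probabilities; they serve as their own indices.
\<close>

definition admissible :: "nat \<Rightarrow> (nat \<Rightarrow> real) pmf \<Rightarrow> bool" where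
  "admissible n P \<longleftrightarrow> finite (set_pmf P) \<and> set_pmf P \<subseteq> {..<n} \<rightarrow>\<^sub>E {0..1}"

definition egalitarian :: "nat \<Rightarrow> (nat \<Rightarrow> real) \<Rightarrow> real" where
  "egalitarian n B = Min (B ` {..<n})"

text \<open>
  Both suprema below are maxima when \<open>n > 0\<close>; see \<open>OPT_attained\<close> and \<open>FLU_attained\<close>.
  Periods are numbered from \<open>0\<close>.
\<close>

definition OPT :: "nat \<Rightarrow> nat \<Rightarrow> (nat \<Rightarrow> nat \<Rightarrow> real) \<Rightarrow> real" where
  "OPT n T b = (SUP x \<in> {..<T} \<rightarrow>\<^sub>E unit_simplex n. egalitarian n (\<lambda>i. \<Sum>t<T. b t i * x t i))"

definition FLU :: "nat \<Rightarrow> (nat \<Rightarrow> real) pmf \<Rightarrow> nat \<Rightarrow> real" where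
  "FLU n P T = (SUP \<xi> \<in> set_pmf P \<rightarrow>\<^sub>E unit_simplex n.
     egalitarian n (\<lambda>i. real T * (\<Sum>\<beta>\<in>set_pmf P. pmf P \<beta> * \<beta> i * \<xi> \<beta> i)))"

definition iid_law :: "(nat \<Rightarrow> real) pmf \<Rightarrow> nat \<Rightarrow> (nat \<Rightarrow> nat \<Rightarrow> real) pmf" where
  "iid_law P T = Pi_pmf {..<T} undefined (\<lambda>_. P)"

lemma compact_PiE_fun:
  fixes K :: "'i \<Rightarrow> 'a::topological_space set"
  assumes "\<And>i. i \<in> I \<Longrightarrow> compact (K i)"
  shows "compact (PiE I K)"
proof -
  define K' where "K' i = (if i \<in> I then K i else {undefined})" for i
  have "PiE I K = PiE UNIV K'"
    unfolding K'_def by (fastforce simp: PiE_iff extensional_def split: if_splits)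
  moreover have "compactin (product_topology (\<lambda>_. euclidean) UNIV) (PiE UNIV K')"
    unfolding compactin_PiE using assms by (auto simp: K'_def)
  ultimately show ?thesis
    by (simp add: euclidean_product_topology)
qed

lemma compact_unit_simplex: "compact (unit_simplex n)"
proof -
  have "unit_simplex n = (PiE {..<n} (\<lambda>_. {0..1})) \<inter> {x. (\<Sum>i<n. x i) = 1}"
  proof (intro equalityI subsetI)
    fix x assume x: "x \<in> unit_simplex n"
    have "x i \<le> 1" if "i < n" for i
      using member_le_sum[of i "{..<n}" x] x that by (auto simp: unit_simplex_def PiE_iff)
    then show "x \<in> (PiE {..<n} (\<lambda>_. {0..1})) \<inter> {x. (\<Sum>i<n. x i) = 1}"
      using x by (auto simp: unit_simplex_def PiE_iff)
  qed (auto simp: unit_simplex_def PiE_iff)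
  moreover have "closed {x :: nat \<Rightarrow> real. (\<Sum>i<n. x i) = 1}"
    by (intro closed_Collect_eq continuous_on_sum continuous_on_const
        continuous_on_product_coordinates)
  ultimately show ?thesis
    by (simp add: compact_Int_closed compact_PiE_fun)
qed

lemma unit_simplex_nonempty:
  assumes "n > 0"
  shows "unit_simplex n \<noteq> {}"
proof -
  have "(\<lambda>i\<in>{..<n}. if i = 0 then 1 else 0) \<in> unit_simplex n"
    using assms by (auto simp: unit_simplex_def)
  then show ?thesis by blast
qed

lemma continuous_on_egalitarian:
  fixes f :: "'a::topological_space \<Rightarrow> nat \<Rightarrow> real"
  assumes "n > 0" "\<And>i. i < n \<Longrightarrow> continuous_on S (\<lambda>x. f x i)"
  shows "continuous_on S (\<lambda>x. egalitarian n (f x))"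
  using assms
proof (induction n rule: nat_induct_non_zero)
  case 1
  then show ?case by (simp add: egalitarian_def lessThan_Suc)
next
  case (Suc n)
  have "egalitarian (Suc n) (f x) = min (f x n) (egalitarian n (f x))" for x
    using Suc.hyps by (auto simp: egalitarian_def lessThan_Suc lessThan_empty_iff intro!: Min_insert)
  then show ?case
    using Suc by (auto intro!: continuous_on_min)
qed

lemma egalitarian_SUP_attained:
  fixes f :: "('j \<Rightarrow> nat \<Rightarrow> real) \<Rightarrow> nat \<Rightarrow> real"
  assumes "n > 0" "\<And>i. i < n \<Longrightarrow> continuous_on UNIV (\<lambda>x. f x i)"
  shows "\<exists>x \<in> J \<rightarrow>\<^sub>E unit_simplex n.
    egalitarian n (f x) = (SUP x \<in> J \<rightarrow>\<^sub>E unit_simplex n. egalitarian n (f x)) \<and>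
    (\<forall>y \<in> J \<rightarrow>\<^sub>E unit_simplex n. egalitarian n (f y) \<le> egalitarian n (f x))"
proof -
  have "compact (J \<rightarrow>\<^sub>E unit_simplex n)"
    by (intro compact_PiE_fun compact_unit_simplex)
  moreover have "J \<rightarrow>\<^sub>E unit_simplex n \<noteq> {}"
    using unit_simplex_nonempty[OF assms(1)] by (simp add: PiE_eq_empty_iff)
  moreover have "continuous_on (J \<rightarrow>\<^sub>E unit_simplex n) (\<lambda>x. egalitarian n (f x))"
    using assms by (intro continuous_on_egalitarian) (auto intro: continuous_on_subset)
  ultimately obtain x where x: "x \<in> J \<rightarrow>\<^sub>E unit_simplex n"
    "\<forall>y \<in> J \<rightarrow>\<^sub>E unit_simplex n. egalitarian n (f y) \<le> egalitarian n (f x)"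
    using continuous_attains_sup by metis
  then have "(SUP x \<in> J \<rightarrow>\<^sub>E unit_simplex n. egalitarian n (f x)) = egalitarian n (f x)"
    by (intro cSup_eq_maximum) auto
  with x show ?thesis by (intro bexI[of _ x]) simp_all
qed

lemma continuous_on_coordinate2:
  "continuous_on UNIV (\<lambda>x :: 'j \<Rightarrow> nat \<Rightarrow> real. x t i)"
  using continuous_on_product_coordinates[where i = t]
  by (rule continuous_on_product_then_coordinatewise)

lemma OPT_attained:
  assumes "n > 0"
  shows "\<exists>x \<in> {..<T} \<rightarrow>\<^sub>E unit_simplex n.
    egalitarian n (\<lambda>i. \<Sum>t<T. b t i * x t i) = OPT n T b \<and>
    (\<forall>y \<in> {..<T} \<rightarrow>\<^sub>E unit_simplex n. egalitarian n (\<lambda>i. \<Sum>t<T. b t i * y t i)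
       \<le> egalitarian n (\<lambda>i. \<Sum>t<T. b t i * x t i))"
  unfolding OPT_def using assms
  by (rule egalitarian_SUP_attained)
    (rule continuous_on_sum continuous_on_mult_left continuous_on_coordinate2)+

lemma FLU_attained:
  assumes "n > 0"
  shows "\<exists>\<xi> \<in> set_pmf P \<rightarrow>\<^sub>E unit_simplex n.
    egalitarian n (\<lambda>i. real T * (\<Sum>\<beta>\<in>set_pmf P. pmf P \<beta> * \<beta> i * \<xi> \<beta> i)) = FLU n P T \<and>
    (\<forall>\<eta> \<in> set_pmf P \<rightarrow>\<^sub>E unit_simplex n.
       egalitarian n (\<lambda>i. real T * (\<Sum>\<beta>\<in>set_pmf P. pmf P \<beta> * \<beta> i * \<eta> \<beta> i))
       \<le> egalitarian n (\<lambda>i. real T * (\<Sum>\<beta>\<in>set_pmf P. pmf P \<beta> * \<beta> i * \<xi> \<beta> i)))"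
  unfolding FLU_def using assms
  by (rule egalitarian_SUP_attained)
    (rule continuous_on_sum continuous_on_mult_left continuous_on_coordinate2)+

end

theory Submission
  imports Defs
begin

text \<open>
  Take two agents and let each period's good be worth \<open>1\<close> to exactly one of them, chosen by a fair
  coin. Then \<open>FLU = T / 2\<close>, while \<open>OPT = (T - \<bar>S\<bar>) / 2\<close> for the simple random walk \<open>S\<close> that counts
  the difference between the goods wanted by the two agents. So the gap is half of \<open>E \<bar>S\<bar>\<close>, which
  is bounded below through \<open>E S\<^sup>2 = T\<close> and \<open>E S\<^sup>4 \<le> 3 T\<^sup>2\<close>.
\<close>

text \<open>The restriction to \<open>{..<n}\<close> makes the vector extensional, so that it can
  serve both as an atom of an admissible law and as a point of
  \<open>unit_simplex n\<close>.\<close>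

definition unit_vec :: "nat \<Rightarrow> nat \<Rightarrow> nat \<Rightarrow> real" where
  "unit_vec n j = (\<lambda>i\<in>{..<n}. of_bool (i = j))"

definition coin_pmf :: "(nat \<Rightarrow> real) pmf" where
  "coin_pmf = pmf_of_set {unit_vec 2 0, unit_vec 2 1}"

definition walk :: "nat \<Rightarrow> (nat \<Rightarrow> nat \<Rightarrow> real) \<Rightarrow> real" where
  "walk T b = (\<Sum>t<T. b t 0 - b t 1)"

lemma unit_vec_neq: "unit_vec 2 0 \<noteq> unit_vec 2 1"
proof
  assume "unit_vec 2 0 = unit_vec 2 1"
  then have "unit_vec 2 0 0 = unit_vec 2 1 0" by simp
  then show False by (simp add: unit_vec_def)
qed

lemma set_coin_pmf [simp]: "set_pmf coin_pmf = {unit_vec 2 0, unit_vec 2 1}"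
  by (simp add: coin_pmf_def)

lemma pmf_coin_pmf [simp]:
  assumes "j < 2"
  shows "pmf coin_pmf (unit_vec 2 j) = 1 / 2"
  using assms unit_vec_neq by (auto simp: coin_pmf_def less_2_cases_iff)

lemma finite_set_iid_law [simp]:
  assumes "finite (set_pmf P)"
  shows "finite (set_pmf (iid_law P T))"
  using assms by (simp add: iid_law_def set_Pi_pmf finite_PiE_dflt)

lemma in_set_iid_law:
  assumes "b \<in> set_pmf (iid_law P T)" "t < T"
  shows "b t \<in> set_pmf P"
  using assms by (auto simp: iid_law_def set_Pi_pmf PiE_dflt_def)

lemma egalitarian_2: "egalitarian 2 B = min (B 0) (B 1)"
  by (simp add: egalitarian_def numeral_2_eq_2 lessThan_Suc min.commute)

lemma unit_simplex_le_1:
  assumes "x \<in> unit_simplex n" "i < n"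
  shows "x i \<le> 1"
  using assms member_le_sum[of i "{..<n}" x] by (auto simp: unit_simplex_def PiE_iff)

text \<open>Conditioning on the last coin, which is independent of the earlier ones and moves the
  walk by 1 or -1, gives a one-step recursion from which all moments of the walk follow by
  induction.\<close>

lemma expectation_iid_coin_Suc:
  fixes f :: "real \<Rightarrow> real"
  shows "measure_pmf.expectation (iid_law coin_pmf (Suc T)) (\<lambda>b. f (walk (Suc T) b))
    = measure_pmf.expectation (iid_law coin_pmf T) (\<lambda>b. (f (walk T b + 1) + f (walk T b - 1)) / 2)"
proof -
  \<comment> \<open>\<open>walk T\<close> reads only the periods below \<open>T\<close>, so
    overwriting period \<open>T\<close> leaves it alone.\<close>
  have "walk T (b(T := v)) = walk T b" for b v
    by (auto simp: walk_def)
  then have step: "walk (Suc T) (b(T := v)) = walk T b + (v 0 - v 1)" for b v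
    by (simp add: walk_def)
  have fin: "finite (set_pmf (iid_law coin_pmf T))"
    by simp
  have "iid_law coin_pmf (Suc T)
      = bind_pmf coin_pmf (\<lambda>v. map_pmf (\<lambda>b. b(T := v)) (iid_law coin_pmf T))"
    unfolding iid_law_def lessThan_Suc by (subst Pi_pmf_insert') (simp_all add: map_pmf_def)
  then have "measure_pmf.expectation (iid_law coin_pmf (Suc T)) (\<lambda>b. f (walk (Suc T) b))
    = (\<Sum>v\<in>{unit_vec 2 0, unit_vec 2 1}.
        measure_pmf.expectation (iid_law coin_pmf T) (\<lambda>b. f (walk T b + (v 0 - v 1)))) / 2"
    using unit_vec_neq
    by (simp add: pmf_expectation_bind[of "{unit_vec 2 0, unit_vec 2 1}"] step add_divide_distrib)
  also have "\<dots> = (measure_pmf.expectation (iid_law coin_pmf T) (\<lambda>b. f (walk T b + 1))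
      + measure_pmf.expectation (iid_law coin_pmf T) (\<lambda>b. f (walk T b - 1))) / 2"
    using unit_vec_neq by (simp add: unit_vec_def)
  also have "\<dots> = measure_pmf.expectation (iid_law coin_pmf T)
      (\<lambda>b. (f (walk T b + 1) + f (walk T b - 1)) / 2)"
    by (simp add: integrable_measure_pmf_finite[OF fin])
  finally show ?thesis .
qed

lemma expectation_walk_power2:
  "measure_pmf.expectation (iid_law coin_pmf T) (\<lambda>b. walk T b ^ 2) = real T"
proof (induction T)
  case 0
  then show ?case by (simp add: walk_def)
next
  case (Suc T)
  have fin: "finite (set_pmf (iid_law coin_pmf T))"
    by simp
  have eq: "((w + 1) ^ 2 + (w - 1) ^ 2) / 2 = w ^ 2 + 1" for w :: real
    by (simp add: power2_eq_square field_simps)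
  show ?case
    unfolding expectation_iid_coin_Suc[where f = "\<lambda>s. s ^ 2"] eq
    by (simp add: Suc.IH integrable_measure_pmf_finite[OF fin])
qed

text \<open>Averaging over a step raises the fourth moment by 6 times the second moment plus 1, that
  is by \<open>6 * T + 1\<close>; these increments add up to the closed form.\<close>

lemma expectation_walk_power4:
  "measure_pmf.expectation (iid_law coin_pmf T) (\<lambda>b. walk T b ^ 4) = 3 * real T ^ 2 - 2 * real T"
proof (induction T)
  case 0
  then show ?case by (simp add: walk_def)
next
  case (Suc T)
  have fin: "finite (set_pmf (iid_law coin_pmf T))"
    by simp
  have eq: "((w + 1) ^ 4 + (w - 1) ^ 4) / 2 = w ^ 4 + 6 * w ^ 2 + 1" for w :: real
    by (simp add: power2_eq_square power4_eq_xxxx field_simps)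
  show ?case
    unfolding expectation_iid_coin_Suc[where f = "\<lambda>s. s ^ 4"] eq
    by (simp add: Suc.IH integrable_measure_pmf_finite[OF fin] expectation_walk_power2)
      (simp add: power2_eq_square algebra_simps)
qed

text \<open>This bounds the first absolute moment from below by the second and fourth ones, with a
  free scale \<open>a\<close>. The constant 4/27 is the least one possible: it is the maximum of
  \<open>(u - 1) / u ^ 3\<close> over u > 0, attained at u = 3/2.\<close>

lemma abs_ge_power2_power4:
  fixes s a :: real
  assumes "a > 0"
  shows "s ^ 2 / a - 4 / 27 * s ^ 4 / a ^ 3 \<le> \<bar>s\<bar>"
proof -
  define u where "u = \<bar>s\<bar> / a"
  have u: "u \<ge> 0" "\<bar>s\<bar> = a * u"
    using assms by (auto simp: u_def)
  have "s ^ 2 = \<bar>s\<bar> ^ 2" "s ^ 4 = \<bar>s\<bar> ^ 4"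
    by simp_all
  then have "s ^ 2 / a - 4 / 27 * s ^ 4 / a ^ 3 = a * (u ^ 2 - 4 / 27 * u ^ 4)"
    unfolding u(2) using assms by (simp add: power2_eq_square power3_eq_cube power4_eq_xxxx field_simps)
  \<comment> \<open>The product expands to \<open>4 * u ^ 4 - 27 * u ^ 2 + 27 * u\<close>, which is
    27 times the difference claimed next; the double root is the point of equality 3/2.\<close>
  moreover have "0 \<le> u * ((2 * u - 3) ^ 2 * (u + 3))"
    using u by simp
  then have "u ^ 2 - 4 / 27 * u ^ 4 \<le> u"
    by (simp add: power2_eq_square power4_eq_xxxx algebra_simps)
  ultimately show ?thesis
    using assms u by (simp add: mult_left_mono)
qed

lemma expectation_abs_walk:
  "measure_pmf.expectation (iid_law coin_pmf T) (\<lambda>b. \<bar>walk T b\<bar>) \<ge> 5 / 9 * sqrt (real T)"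
proof (cases "T = 0")
  case False
  define a where "a = sqrt (real T)"
  have a: "a > 0" "real T = a ^ 2"
    using False by (auto simp: a_def)
  have fin: "finite (set_pmf (iid_law coin_pmf T))"
    by simp
  note int = integrable_measure_pmf_finite[OF fin]
  \<comment> \<open>With the scale \<open>a = sqrt T\<close> both moment terms have order
    \<open>a\<close>: the leading coefficient is 1 - 12/27 = 5/9, and the remaining term
    \<open>8 / (27 * a)\<close> is positive and dropped.\<close>
  have "5 / 9 * a \<le> real T / a - 4 / 27 * (3 * real T ^ 2 - 2 * real T) / a ^ 3"
    unfolding a(2) using a(1) by (simp add: field_simps power2_eq_square power3_eq_cube)
  also have "\<dots> = measure_pmf.expectation (iid_law coin_pmf T)
      (\<lambda>b. walk T b ^ 2 / a - 4 / 27 * walk T b ^ 4 / a ^ 3)"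
    by (simp add: int expectation_walk_power2 expectation_walk_power4)
  also have "\<dots> \<le> measure_pmf.expectation (iid_law coin_pmf T) (\<lambda>b. \<bar>walk T b\<bar>)"
    by (intro integral_mono int abs_ge_power2_power4 a)
  finally show ?thesis by (simp add: a_def)
qed (simp add: walk_def)

text \<open>Comparison with a maximizer from \<open>FLU_attained\<close> takes the place of a
  separate boundedness argument for the supremum.\<close>

lemma FLU_upper:
  assumes "n > 0" "\<xi> \<in> set_pmf P \<rightarrow>\<^sub>E unit_simplex n"
  shows "egalitarian n (\<lambda>i. real T * (\<Sum>\<beta>\<in>set_pmf P. pmf P \<beta> * \<beta> i * \<xi> \<beta> i)) \<le> FLU n P T"
proof -
  from FLU_attained[OF assms(1), of P T] obtain \<eta> where
    "egalitarian n (\<lambda>i. real T * (\<Sum>\<beta>\<in>set_pmf P. pmf P \<beta> * \<beta> i * \<eta> \<beta> i)) = FLU n P T"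
    "\<forall>\<zeta> \<in> set_pmf P \<rightarrow>\<^sub>E unit_simplex n.
       egalitarian n (\<lambda>i. real T * (\<Sum>\<beta>\<in>set_pmf P. pmf P \<beta> * \<beta> i * \<zeta> \<beta> i))
       \<le> egalitarian n (\<lambda>i. real T * (\<Sum>\<beta>\<in>set_pmf P. pmf P \<beta> * \<beta> i * \<eta> \<beta> i))"
    by (elim bexE conjE)
  from bspec[OF this(2) assms(2)] this(1) show ?thesis by (rule ord_le_eq_trans)
qed

lemma FLU_coin_ge: "FLU 2 coin_pmf T \<ge> real T / 2"
proof -
  \<comment> \<open>Each good goes entirely to the agent who values it; as the atoms are unit
    vectors, this allocation is the identity.\<close>
  define \<xi> where "\<xi> = (\<lambda>\<beta>\<in>set_pmf coin_pmf. \<beta>)"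
  have "\<xi> \<in> set_pmf coin_pmf \<rightarrow>\<^sub>E unit_simplex 2"
    by (auto simp: \<xi>_def unit_simplex_def unit_vec_def numeral_2_eq_2)
  moreover have eq: "egalitarian 2 (\<lambda>i. real T * (\<Sum>\<beta>\<in>set_pmf coin_pmf. pmf coin_pmf \<beta> * \<beta> i * \<xi> \<beta> i))
      = real T / 2"
    using unit_vec_neq
    by (simp add: egalitarian_2 \<xi>_def) (simp add: unit_vec_def)
  ultimately show ?thesis
    using FLU_upper[of 2 \<xi> coin_pmf T] unfolding eq by simp
qed

text \<open>No agent can get more than the number of goods it wants. The two numbers add up to
  \<open>T\<close> and differ by the walk, so the smaller one is the right-hand side.\<close>

lemma OPT_coin_le:
  assumes "b \<in> set_pmf (iid_law coin_pmf T)"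
  shows "OPT 2 T b \<le> (real T - \<bar>walk T b\<bar>) / 2"
proof -
  have b: "b t = unit_vec 2 0 \<or> b t = unit_vec 2 1" if "t < T" for t
    using in_set_iid_law[OF assms that] by simp
  obtain x where x: "x \<in> {..<T} \<rightarrow>\<^sub>E unit_simplex 2"
    "egalitarian 2 (\<lambda>i. \<Sum>t<T. b t i * x t i) = OPT 2 T b"
    using OPT_attained[of 2 T b] by auto
  have le: "(\<Sum>t<T. b t i * x t i) \<le> (\<Sum>t<T. b t i)" if "i < 2" for i
  proof (rule sum_mono)
    fix t assume "t \<in> {..<T}"
    then have "x t i \<le> 1" "b t i \<ge> 0"
      using b[of t] x(1) that unit_simplex_le_1[of "x t" 2 i] by (auto simp: unit_vec_def PiE_iff)
    then show "b t i * x t i \<le> b t i"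
      by (simp add: mult_left_le)
  qed
  have "(\<Sum>t<T. b t 0) + (\<Sum>t<T. b t 1) = (\<Sum>t<T. 1)"
    unfolding sum.distrib[symmetric] by (rule sum.cong) (use b in \<open>force simp: unit_vec_def\<close>)+
  moreover have "walk T b = (\<Sum>t<T. b t 0) - (\<Sum>t<T. b t 1)"
    by (simp add: walk_def sum_subtractf)
  moreover have "OPT 2 T b \<le> (\<Sum>t<T. b t i)" if "i < 2" for i
    using le[OF that] that unfolding x(2)[symmetric] egalitarian_2
    by (auto simp: less_2_cases_iff min_le_iff_disj)
  from this[of 0] this[of 1] have "OPT 2 T b \<le> (\<Sum>t<T. b t 0)" "OPT 2 T b \<le> (\<Sum>t<T. b t 1)"
    by simp_all
  ultimately show ?thesis
    by (simp add: abs_if)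
qed

lemma FLU_minus_expectation_OPT_coin:
  "FLU 2 coin_pmf T - measure_pmf.expectation (iid_law coin_pmf T) (OPT 2 T)
    \<ge> 5 / 18 * sqrt (real T)"
proof -
  have fin: "finite (set_pmf (iid_law coin_pmf T))"
    by simp
  note int = integrable_measure_pmf_finite[OF fin]
  \<comment> \<open>\<open>OPT_coin_le\<close> holds on the support of the law, so the integrands
    are compared almost everywhere.\<close>
  have "measure_pmf.expectation (iid_law coin_pmf T) (OPT 2 T)
      \<le> measure_pmf.expectation (iid_law coin_pmf T) (\<lambda>b. (real T - \<bar>walk T b\<bar>) / 2)"
    by (intro integral_mono_AE int AE_pmfI OPT_coin_le)
  also have "\<dots> = (real T - measure_pmf.expectation (iid_law coin_pmf T) (\<lambda>b. \<bar>walk T b\<bar>)) / 2"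
    by (simp add: int)
  finally show ?thesis
    using FLU_coin_ge[of T] expectation_abs_walk[of T] by simp
qed

theorem mainTheorem6:
  shows "\<exists>(n::nat) (P :: (nat \<Rightarrow> real) pmf). n > 0 \<and> admissible n P \<and>
    liminf (\<lambda>T. ereal ((FLU n P T - measure_pmf.expectation (iid_law P T) (OPT n T)) / sqrt (real T))) > 0"
proof (intro exI conjI)
  show "(2::nat) > 0" by simp
  show "admissible 2 coin_pmf"
    by (auto simp: admissible_def unit_vec_def)
  have "\<forall>\<^sub>F T in sequentially. ereal (5 / 18) \<le> ereal ((FLU 2 coin_pmf T
      - measure_pmf.expectation (iid_law coin_pmf T) (OPT 2 T)) / sqrt (real T))"
    \<comment> \<open>Positive \<open>T\<close> allows division by \<open>sqrt T\<close>.\<close>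
    using eventually_gt_at_top[of 0]
    by eventually_elim (use FLU_minus_expectation_OPT_coin in \<open>simp add: field_simps\<close>)
  then have "ereal (5 / 18) \<le> liminf (\<lambda>T. ereal ((FLU 2 coin_pmf T
      - measure_pmf.expectation (iid_law coin_pmf T) (OPT 2 T)) / sqrt (real T)))"
    by (rule Liminf_bounded)
  then show "liminf (\<lambda>T. ereal ((FLU 2 coin_pmf T
      - measure_pmf.expectation (iid_law coin_pmf T) (OPT 2 T)) / sqrt (real T))) > 0"
    by (rule less_le_trans[rotated]) simp
qed

end
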